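(* Let $F:\mathbb{N}\to\mathbb{C}$ be such that all Wintner coefficients $\mathrm{Win}_qF$ ($q\in\mathbb{N}$) exist and only finitely many of them are nonzero. Then the following three conditions are equivalent: (i) $\mathrm{supp}(F')$ is finite; (ii) for every $d\in\mathbb{N}$, $\displaystyle\lim_P \sum_{r\in )P(,\ r>1}\frac{F'(dr)}{r}=0$; (iii) there exists $Q\in\mathbb{N}$ with $\mathrm{supp}(F')\subseteq (Q)$.
   Context: $F'=F*\mu$ is the Eratosthenes transform, $F'(d)=\sum_{a\mid d}F(a)\mu(d/a)$. $\mathrm{Win}_qF=\sum_{d\equiv0\bmod q}F'(d)/d$ (convergent series). For $V\in\mathbb{N}$, $(V)$ is the set of $n\in\mathbb{N}$ with no prime factor $>V$ and $)V($ is the set of $n\in\mathbb{N}$ with no prime factor $\le V$. For a prime $P$ and $d\in\mathbb{N}$, the series $\sum_{r\in )P(,\,r>1}F'(dr)/r$ is defined as $\lim_{x\to\infty}\sum_{r\in )P(,\,1<r\le x}F'(dr)/r$. $\lim_P$ is the limit as $P\to\infty$ through primes; $\mathrm{supp}(G)=\{n:G(n)\neq0\}$. *)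

theory Defs
  imports Complex_Main "HOL-Computational_Algebra.Computational_Algebra"
begin

text \<open>Arithmetic functions are functions on the positive integers; they are represented by
  functions on \<open>nat\<close> whose value at \<open>0\<close> is never consulted.\<close>

definition moebius :: "nat \<Rightarrow> complex" where
  "moebius n = (if squarefree n then (-1) ^ card (prime_factors n) else 0)"

definition eratosthenes :: "(nat \<Rightarrow> complex) \<Rightarrow> nat \<Rightarrow> complex" where
  "eratosthenes F d = (\<Sum>a | a dvd d. F a * moebius (d div a))"

definition arith_supp :: "(nat \<Rightarrow> complex) \<Rightarrow> nat set" where
  "arith_supp G = {n. n > 0 \<and> G n \<noteq> 0}"

definition win_partial :: "(nat \<Rightarrow> complex) \<Rightarrow> nat \<Rightarrow> nat \<Rightarrow> complex" where
  "win_partial F q x = (\<Sum>d | 0 < d \<and> d \<le> x \<and> q dvd d. eratosthenes F d / of_nat d)"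

definition win_exists :: "(nat \<Rightarrow> complex) \<Rightarrow> nat \<Rightarrow> bool" where
  "win_exists F q \<longleftrightarrow> convergent (win_partial F q)"

definition win :: "(nat \<Rightarrow> complex) \<Rightarrow> nat \<Rightarrow> complex" where
  "win F q = lim (win_partial F q)"

definition smooth_numbers :: "nat \<Rightarrow> nat set" where  \<comment> \<open>the set \<open>(V)\<close>\<close>
  "smooth_numbers V = {n. n > 0 \<and> (\<forall>p. prime p \<and> p dvd n \<longrightarrow> p \<le> V)}"

definition sifted_numbers :: "nat \<Rightarrow> nat set" where  \<comment> \<open>the set \<open>)V(\<close>\<close>
  "sifted_numbers V = {n. n > 0 \<and> (\<forall>p. prime p \<and> p dvd n \<longrightarrow> p > V)}"

definition sifted_partial :: "(nat \<Rightarrow> complex) \<Rightarrow> nat \<Rightarrow> nat \<Rightarrow> nat \<Rightarrow> complex" where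
  "sifted_partial F d P x =
     (\<Sum>r | r \<in> sifted_numbers P \<and> 1 < r \<and> r \<le> x. eratosthenes F (d * r) / of_nat r)"

definition sifted_series :: "(nat \<Rightarrow> complex) \<Rightarrow> nat \<Rightarrow> nat \<Rightarrow> complex" where
  "sifted_series F d P = lim (sifted_partial F d P)"

definition primes_at_top :: "nat filter" where
  "primes_at_top = inf at_top (principal {p. prime p})"

end

theory Submission
  imports Defs
begin

text \<open>Sieving out one prime \<open>p\<close> from the series \<open>\<Sum> F'(dr)/r\<close> subtracts \<open>1/p\<close> times the same series
  with \<open>dp\<close> in place of \<open>d\<close>. Starting from \<open>d Win\<^sub>d F\<close>, the sifted series therefore all converge,
  and if \<open>Win\<^sub>q F = 0\<close> for all \<open>q > N\<close> then they vanish for \<open>d > N\<close>. Removing the term \<open>r = 1\<close>, the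
  series in (ii) equals \<open>- F'(d)\<close> for every \<open>d > N\<close> and every \<open>P\<close>, so (ii) forces \<open>F'(d) = 0\<close>.\<close>

text \<open>An arbitrary set \<open>A\<close> of primes replaces the bound \<open>P\<close>, so that
  primes can be sieved out one at a time by induction on \<open>A\<close>. The term
  \<open>r = 1\<close> is kept, in contrast to \<open>sifted_partial\<close>; with it the recursion
  in \<open>A\<close> has no correction terms.\<close>

definition sieve_partial :: "(nat \<Rightarrow> 'a::real_normed_field) \<Rightarrow> nat set \<Rightarrow> nat \<Rightarrow> nat \<Rightarrow> 'a" where
  "sieve_partial G A d x = (\<Sum>r | 0 < r \<and> r \<le> x \<and> (\<forall>p\<in>A. \<not> p dvd r). G (d * r) / of_nat r)"

text \<open>The terms lost are those with \<open>r = p * s\<close>. Their factor \<open>p\<close>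
  moves into the argument of \<open>G\<close> and leaves \<open>1/p\<close> outside, while the
  cutoff for \<open>s\<close> becomes \<open>x div p\<close>. Here \<open>s\<close> is sieved by
  \<open>A\<close> only, so it may again be divisible by \<open>p\<close>.\<close>

lemma sieve_partial_insert:
  assumes "prime p" "p \<notin> A" "\<And>q. q \<in> A \<Longrightarrow> prime q"
  shows "sieve_partial G (insert p A) d x =
           sieve_partial G A d x - sieve_partial G A (d * p) (x div p) / of_nat p"
proof -
  let ?B = "{r. 0 < r \<and> r \<le> x \<and> (\<forall>q\<in>A. \<not> q dvd r)}"
  let ?C = "{s. 0 < s \<and> s \<le> x div p \<and> (\<forall>q\<in>A. \<not> q dvd s)}"
  have p0: "p > 0" using assms(1) prime_gt_0_nat by blast
  have fin: "finite ?B" by simp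
  have img: "{r \<in> ?B. p dvd r} = (\<lambda>s. p * s) ` ?C"
  proof (intro subset_antisym subsetI)
    fix r assume r: "r \<in> {r \<in> ?B. p dvd r}"
    then obtain s where s: "r = p * s" by auto
    have "s \<in> ?C" using r s p0 by (auto simp: less_eq_div_iff_mult_less_eq mult.commute)
    then show "r \<in> (\<lambda>s. p * s) ` ?C" using s by blast
  next
    fix r assume "r \<in> (\<lambda>s. p * s) ` ?C"
    then obtain s where s: "s \<in> ?C" "r = p * s" by blast
    \<comment> \<open>As \<open>p\<close> is a prime outside \<open>A\<close>, multiplying by
      \<open>p\<close> creates no divisor from \<open>A\<close>.\<close>
    have "\<not> q dvd r" if "q \<in> A" for q
    proof -
      have "\<not> q dvd p" using that assms primes_dvd_imp_eq by blast
      moreover have "\<not> q dvd s" using that s by blast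
      ultimately show ?thesis using s(2) assms(3)[OF that] prime_dvd_mult_iff by blast
    qed
    then show "r \<in> {r \<in> ?B. p dvd r}"
      using s p0 by (auto simp: less_eq_div_iff_mult_less_eq mult.commute)
  qed
  have inj: "inj_on (\<lambda>s. p * s) ?C" using p0 by (auto simp: inj_on_def)
  have "sieve_partial G A d x =
          (\<Sum>r | r \<in> ?B \<and> p dvd r. G (d * r) / of_nat r) + (\<Sum>r | r \<in> ?B \<and> \<not> p dvd r. G (d * r) / of_nat r)"
    unfolding sieve_partial_def using fin
    by (subst sum.union_disjoint[symmetric]) (auto intro!: sum.cong)
  also have "(\<Sum>r | r \<in> ?B \<and> \<not> p dvd r. G (d * r) / of_nat r) = sieve_partial G (insert p A) d x"
    unfolding sieve_partial_def by (rule sum.cong) auto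
  also have "(\<Sum>r | r \<in> ?B \<and> p dvd r. G (d * r) / of_nat r) =
               (\<Sum>s\<in>?C. G (d * (p * s)) / of_nat (p * s))"
    using img inj by (simp add: sum.reindex)
  also have "\<dots> = sieve_partial G A (d * p) (x div p) / of_nat p"
    unfolding sieve_partial_def sum_divide_distrib by (rule sum.cong) (auto simp: mult_ac)
  finally show ?thesis by simp
qed

lemma sieve_partial_insert_tendsto:
  assumes "prime p" "p \<notin> A" "\<And>q. q \<in> A \<Longrightarrow> prime q"
    and "sieve_partial G A d \<longlonglongrightarrow> l" "sieve_partial G A (d * p) \<longlonglongrightarrow> m"
  shows "sieve_partial G (insert p A) d \<longlonglongrightarrow> l - m / of_nat p"
proof -
  have "p > 0" using assms(1) prime_gt_0_nat by blast
  \<comment> \<open>From \<open>x >= Z * p\<close> on, the cutoff \<open>x div p\<close> is at least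
    \<open>Z\<close>, so the shortened sums have the same limit.\<close>
  then have "filterlim (\<lambda>x. x div p) at_top at_top"
    unfolding filterlim_at_top eventually_at_top_linorder
    by (metis less_eq_div_iff_mult_less_eq)
  then have "(\<lambda>x. sieve_partial G A (d * p) (x div p)) \<longlonglongrightarrow> m"
    using assms(5) by (rule filterlim_compose[rotated])
  moreover have "of_nat p \<noteq> (0 :: 'a)" using \<open>p > 0\<close> by simp
  ultimately have "(\<lambda>x. sieve_partial G A d x - sieve_partial G A (d * p) (x div p) / of_nat p)
                     \<longlonglongrightarrow> l - m / of_nat p"
    using assms(4) by (intro tendsto_intros)
  moreover have "sieve_partial G (insert p A) d =
      (\<lambda>x. sieve_partial G A d x - sieve_partial G A (d * p) (x div p) / of_nat p)"
    using sieve_partial_insert[of p A] assms(1-3) by blast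
  ultimately show ?thesis by simp
qed

text \<open>Induction on \<open>A\<close> with \<open>d\<close> arbitrary, since adding
  \<open>p\<close> calls on the series at \<open>d\<close> and at \<open>d * p\<close>.\<close>

lemma sieve_partial_convergent:
  assumes "finite A" "\<And>p. p \<in> A \<Longrightarrow> prime p"
    and "\<And>d. d > 0 \<Longrightarrow> convergent (sieve_partial G {} d)" and "d > 0"
  shows "convergent (sieve_partial G A d)"
  using assms(1,2,4)
proof (induction A arbitrary: d rule: finite_induct)
  case empty
  then show ?case using assms(3) by simp
next
  case (insert p A)
  have "d * p > 0" using insert.prems prime_gt_0_nat by simp
  then obtain l m where "sieve_partial G A d \<longlonglongrightarrow> l" "sieve_partial G A (d * p) \<longlonglongrightarrow> m"
    using insert.IH[of d] insert.IH[of "d * p"] insert.prems unfolding convergent_def by auto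
  then show ?case
    using sieve_partial_insert_tendsto[of p A G d l m] insert.prems insert.hyps
    unfolding convergent_def by auto
qed

text \<open>The same induction stays inside the range \<open>d > N\<close>, because passing from
  \<open>d\<close> to \<open>d * p\<close> only increases the index.\<close>

lemma sieve_partial_null:
  assumes "finite A" "\<And>p. p \<in> A \<Longrightarrow> prime p"
    and "\<And>d. d > N \<Longrightarrow> sieve_partial G {} d \<longlonglongrightarrow> 0" and "d > N"
  shows "sieve_partial G A d \<longlonglongrightarrow> 0"
  using assms(1,2,4)
proof (induction A arbitrary: d rule: finite_induct)
  case empty
  then show ?case using assms(3) by simp
next
  case (insert p A)
  have "d * 1 \<le> d * p" using insert.prems prime_gt_0_nat[of p] by (intro mult_le_mono) auto
  then have "d * p > N" using insert.prems(2) by linarith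
  then show ?case
    using sieve_partial_insert_tendsto[of p A G d 0 0] insert by simp
qed

text \<open>Substitute \<open>e = d * r\<close>, so that \<open>1/r = d/e\<close>. The unsieved sums
  are thus, up to the factor \<open>d\<close>, a subsequence of the Wintner partial sums.\<close>

lemma sieve_partial_empty_eq_win_partial:
  assumes "d > 0"
  shows "sieve_partial (eratosthenes F) {} d x = of_nat d * win_partial F d (d * x)"
proof -
  have "{e. 0 < e \<and> e \<le> d * x \<and> d dvd e} = (\<lambda>r. d * r) ` {r. 0 < r \<and> r \<le> x}"
    using assms by auto
  moreover have "inj_on (\<lambda>r. d * r) {r. 0 < r \<and> r \<le> x}" using assms by (auto simp: inj_on_def)
  ultimately show ?thesis
    using assms by (simp add: win_partial_def sieve_partial_def sum.reindex sum_distrib_left)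
qed

lemma sieve_partial_empty_tendsto:
  assumes "win_exists F d" "d > 0"
  shows "sieve_partial (eratosthenes F) {} d \<longlonglongrightarrow> of_nat d * win F d"
proof -
  have "win_partial F d \<longlonglongrightarrow> win F d"
    using assms(1) by (simp add: win_exists_def win_def convergent_LIMSEQ_iff)
  moreover have "filterlim (\<lambda>x. d * x) at_top at_top"
    using assms(2) by (simp add: mult_nat_left_at_top)
  ultimately have "(\<lambda>x. win_partial F d (d * x)) \<longlonglongrightarrow> win F d" by (rule filterlim_compose)
  then show ?thesis
    unfolding sieve_partial_empty_eq_win_partial[OF assms(2), abs_def] by (intro tendsto_intros)
qed

text \<open>The term \<open>r = 1\<close> contributes \<open>eratosthenes F d\<close>. It is within
  the cutoff only once \<open>x >= 1\<close>; at \<open>x = 0\<close> both sums are empty.\<close>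

lemma sieve_partial_eq_sifted_partial:
  assumes "x \<ge> 1"
  shows "sieve_partial (eratosthenes F) {p. prime p \<and> p \<le> P} d x =
           eratosthenes F d + sifted_partial F d P x"
proof -
  have "{r. 0 < r \<and> r \<le> x \<and> (\<forall>p\<in>{p. prime p \<and> p \<le> P}. \<not> p dvd r)} =
          insert 1 {r. r \<in> sifted_numbers P \<and> 1 < r \<and> r \<le> x}"
    using assms by (auto simp: sifted_numbers_def not_le)
  then show ?thesis by (simp add: sieve_partial_def sifted_partial_def)
qed

lemma sifted_partial_tendsto_iff:
  "sifted_partial F d P \<longlonglongrightarrow> l - eratosthenes F d \<longleftrightarrow>
   sieve_partial (eratosthenes F) {p. prime p \<and> p \<le> P} d \<longlonglongrightarrow> l"
proof -
  have "sieve_partial (eratosthenes F) {p. prime p \<and> p \<le> P} d \<longlonglongrightarrow> l \<longleftrightarrow>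
          (\<lambda>x. eratosthenes F d + sifted_partial F d P x) \<longlonglongrightarrow> l"
    by (rule tendsto_cong)
      (auto intro!: eventually_mono[OF eventually_ge_at_top[of 1]] sieve_partial_eq_sifted_partial)
  also have "\<dots> \<longleftrightarrow> sifted_partial F d P \<longlonglongrightarrow> l - eratosthenes F d"
    using tendsto_add_const_iff[of "eratosthenes F d" "sifted_partial F d P" "l - eratosthenes F d"]
    by simp
  finally show ?thesis by simp
qed

lemma eventually_primes_at_top:
  "eventually Q primes_at_top \<longleftrightarrow> (\<exists>N. \<forall>p\<ge>N. prime p \<longrightarrow> Q p)"
  by (auto simp: primes_at_top_def eventually_inf_principal eventually_at_top_linorder)

text \<open>This is the infinitude of primes. It makes limits along the filter unique, so a constant
  tending to 0 there must be 0.\<close>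

lemma primes_at_top_neq_bot: "primes_at_top \<noteq> bot"
proof -
  have "\<not> eventually (\<lambda>_. False) primes_at_top"
    unfolding eventually_primes_at_top by (meson bigger_prime less_imp_le)
  then show ?thesis by (simp add: trivial_limit_def)
qed

text \<open>Any \<open>r > 1\<close> free of primes up to \<open>P\<close> has a prime factor above
  \<open>P >= Q\<close>, which puts \<open>d * r\<close> outside the \<open>Q\<close>-smooth numbers
  and hence outside the support.\<close>

lemma sifted_partial_eq_0:
  assumes "arith_supp (eratosthenes F) \<subseteq> smooth_numbers Q" "Q \<le> P" "d > 0"
  shows "sifted_partial F d P x = 0"
  unfolding sifted_partial_def
proof (intro sum.neutral ballI)
  fix r assume r: "r \<in> {r. r \<in> sifted_numbers P \<and> 1 < r \<and> r \<le> x}"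
  then obtain p where p: "prime p" "p dvd r" using prime_factor_nat[of r] by auto
  then have "p > Q" using r assms(2) by (auto simp: sifted_numbers_def)
  moreover have "p dvd d * r" using p by simp
  ultimately have "d * r \<notin> smooth_numbers Q" using p by (auto simp: smooth_numbers_def not_le)
  then have "d * r \<notin> arith_supp (eratosthenes F)" using assms(1) by blast
  then have "eratosthenes F (d * r) = 0" using assms(3) r by (simp add: arith_supp_def)
  then show "eratosthenes F (d * r) / of_nat r = 0" by simp
qed

lemma finite_imp_subset_smooth_numbers:
  assumes "finite S" "0 \<notin> S"
  shows "\<exists>Q>0. S \<subseteq> smooth_numbers Q"
proof -
  obtain Q where Q: "\<forall>n\<in>S. n \<le> Q" using assms(1) finite_nat_set_iff_bounded_le by blast
  \<comment> \<open>The successor guarantees a positive bound even when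
    \<open>Q = 0\<close>.\<close>
  have "n \<in> smooth_numbers (Suc Q)" if "n \<in> S" for n
  proof -
    have "n > 0" using that assms(2) by (cases n) auto
    moreover have "p \<le> Suc Q" if "p dvd n" for p
      using dvd_imp_le[OF that \<open>n > 0\<close>] Q \<open>n \<in> S\<close> by (meson le_SucI le_trans)
    ultimately show ?thesis by (simp add: smooth_numbers_def)
  qed
  then show ?thesis by blast
qed

theorem theorem2:
  fixes F :: "nat \<Rightarrow> complex"
  assumes "\<And>q. q > 0 \<Longrightarrow> win_exists F q"
    and "finite (arith_supp (win F))"
  shows "(finite (arith_supp (eratosthenes F)) \<longleftrightarrow>
            (\<forall>d>0. (\<forall>P. prime P \<longrightarrow> convergent (sifted_partial F d P)) \<and>
                   (sifted_series F d \<longlongrightarrow> 0) primes_at_top)) \<and>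
         ((\<forall>d>0. (\<forall>P. prime P \<longrightarrow> convergent (sifted_partial F d P)) \<and>
                   (sifted_series F d \<longlongrightarrow> 0) primes_at_top) \<longleftrightarrow>
            (\<exists>Q>0. arith_supp (eratosthenes F) \<subseteq> smooth_numbers Q))"
    (is "(?fin \<longleftrightarrow> ?lim) \<and> (_ \<longleftrightarrow> ?smooth)")
proof -
  let ?G = "eratosthenes F"
  let ?A = "\<lambda>P. {p::nat. prime p \<and> p \<le> P}"
  obtain N where N: "\<forall>q\<in>arith_supp (win F). q \<le> N"
    using assms(2) unfolding finite_nat_set_iff_bounded_le by (elim exE)
  have null: "sieve_partial ?G {} d \<longlonglongrightarrow> 0" if "d > N" for d
  proof -
    have "d \<notin> arith_supp (win F)" using N that by (auto simp: not_le[symmetric])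
    then have "win F d = 0" using that by (simp add: arith_supp_def)
    then show ?thesis using sieve_partial_empty_tendsto[OF assms(1), of d] that by simp
  qed
  have conv: "convergent (sieve_partial ?G (?A P) d)" if "d > 0" for P d
  proof (rule sieve_partial_convergent)
    show "convergent (sieve_partial ?G {} e)" if "e > 0" for e
      using sieve_partial_empty_tendsto[OF assms(1)[OF that] that] by (rule convergentI)
  qed (use that in auto)
  \<comment> \<open>The equivalences follow from the cycle (i) to (iii) to (ii) to (i).\<close>
  have "?smooth" if "?fin"
    using that by (intro finite_imp_subset_smooth_numbers) (auto simp: arith_supp_def)
  moreover have "?lim" if "?smooth"
  proof (intro allI impI conjI)
    \<comment> \<open>Since \<open>lim\<close> is total, (ii) also asserts convergence of each
      sifted series; this comes from the existence of all Wintner coefficients via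
      \<open>conv\<close>.\<close>
    fix d P :: nat assume "d > 0"
    then obtain l where "sieve_partial ?G (?A P) d \<longlonglongrightarrow> l" using conv convergent_def by blast
    then show "convergent (sifted_partial F d P)"
      using sifted_partial_tendsto_iff convergent_def by blast
  next
    fix d :: nat assume "d > 0"
    from \<open>?smooth\<close> obtain Q where "arith_supp ?G \<subseteq> smooth_numbers Q" by blast
    then have "sifted_partial F d P = (\<lambda>_. 0)" if "P \<ge> Q" for P
      using sifted_partial_eq_0 that \<open>d > 0\<close> by blast
    then have "sifted_series F d P = 0" if "P \<ge> Q" for P
      using that by (simp add: sifted_series_def)
    then have "eventually (\<lambda>P. sifted_series F d P = 0) primes_at_top"
      unfolding eventually_primes_at_top by blast
    then show "(sifted_series F d \<longlongrightarrow> 0) primes_at_top" by (rule tendsto_eventually)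
  qed
  moreover have "?fin" if "?lim"
  proof -
    have "?G d = 0" if "d > N" for d
    proof -
      have "sieve_partial ?G (?A P) d \<longlonglongrightarrow> 0" for P
        by (rule sieve_partial_null[OF _ _ null that]) auto
      then have "sifted_partial F d P \<longlonglongrightarrow> 0 - ?G d" for P
        unfolding sifted_partial_tendsto_iff .
      \<comment> \<open>The full sieved series is 0, so what remains without \<open>r = 1\<close>
        does not depend on \<open>P\<close>.\<close>
      then have "sifted_series F d = (\<lambda>_. - ?G d)"
        using limI by (fastforce simp: sifted_series_def)
      moreover have "(sifted_series F d \<longlongrightarrow> 0) primes_at_top" using \<open>?lim\<close> that by simp
      ultimately have "((\<lambda>_. - ?G d) \<longlongrightarrow> 0) primes_at_top" by (simp only:)
      then show ?thesis using primes_at_top_neq_bot by (simp add: tendsto_const_iff)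
    qed
    then have "arith_supp ?G \<subseteq> {..N}" by (force simp: arith_supp_def not_less)
    then show ?thesis using finite_subset by blast
  qed
  ultimately show ?thesis by blast
qed

end
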